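(* Let $\Sigma=\{a,b\}$ and let $h:\Sigma^*\to\Sigma^*$ be the morphism given by $h(a)=aaaab$ and $h(b)=ababab$. Then the fixed point $h^\omega(a)$ is abelian $5$-power free and does not contain the factor $bb$. However, for every $k\ge 2$, the morphism $h$ is not abelian $k$-power free.
   Context: $\Sigma^*$ is the free monoid of finite words over $\Sigma$, with empty word $\epsilon$; a morphism is a monoid homomorphism. Since $h(a)$ begins with $a$ and has length greater than $1$, each $h^n(a)$ is a proper prefix of $h^{n+1}(a)$, and $h^\omega(a)$ denotes the infinite word having every $h^n(a)$ as a prefix (a fixed point of $h$). A factor of a word is a contiguous finite subword. The Parikh vector $\psi(u)$ of a finite word $u$ records the number of occurrences of each letter in $u$. A word $u$ (finite or infinite) is abelian $k$-power free if whenever $u=xv_1\cdots v_ky$ with $\psi(v_1)=\cdots=\psi(v_k)$, one has $v_1=\cdots=v_k=\epsilon$. A morphism $h$ is abelian $k$-power free if $h(u)$ is abelian $k$-power free for every abelian $k$-power free word $u$. *)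

theory Defs
  imports "HOL-Library.Omega_Words_Fun"
begin

text \<open>Finite words are lists; infinite words are the functions from \<^typ>\<open>nat\<close> of
  \<^theory>\<open>HOL-Library.Omega_Words_Fun\<close>.\<close>

datatype letter = La | Lb

definition word_morphism :: "('a list \<Rightarrow> 'b list) \<Rightarrow> bool" where
  "word_morphism h \<longleftrightarrow> h [] = [] \<and> (\<forall>u v. h (u @ v) = h u @ h v)"

definition omega_limit :: "('a list \<Rightarrow> 'a list) \<Rightarrow> 'a \<Rightarrow> 'a word" where
  "omega_limit h a = (THE w. \<forall>n. prefix (length ((h ^^ n) [a])) w = (h ^^ n) [a])"

definition omega_factor :: "'a list \<Rightarrow> 'a word \<Rightarrow> bool" where
  "omega_factor u w \<longleftrightarrow> (\<exists>x y. w = x \<frown> u \<frown> y)"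

definition parikh :: "'a list \<Rightarrow> 'a \<Rightarrow> nat" where
  "parikh u = (\<lambda>c. count_list u c)"

definition abelian_power_free :: "nat \<Rightarrow> 'a list \<Rightarrow> bool" where
  "abelian_power_free k u \<longleftrightarrow>
     (\<forall>x vs y. length vs = k \<and> u = x @ concat vs @ y \<and>
        (\<forall>v\<in>set vs. \<forall>v'\<in>set vs. parikh v = parikh v') \<longrightarrow> (\<forall>v\<in>set vs. v = []))"

definition omega_abelian_power_free :: "nat \<Rightarrow> 'a word \<Rightarrow> bool" where
  "omega_abelian_power_free k w \<longleftrightarrow>
     (\<forall>x vs y. length vs = k \<and> w = x \<frown> concat vs \<frown> y \<and>
        (\<forall>v\<in>set vs. \<forall>v'\<in>set vs. parikh v = parikh v') \<longrightarrow> (\<forall>v\<in>set vs. v = []))"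

definition abelian_power_free_morphism :: "nat \<Rightarrow> ('a list \<Rightarrow> 'b list) \<Rightarrow> bool" where
  "abelian_power_free_morphism k h \<longleftrightarrow>
     (\<forall>u. abelian_power_free k u \<longrightarrow> abelian_power_free k (h u))"

text \<open>The description in \<^const>\<open>omega_limit\<close> is proper when \<open>h\<close> is non-erasing and
  \<open>h(a)\<close> is a proper extension of \<open>a\<close>; the word obtained is then a fixed point, in the
  sense that \<open>h\<close> maps its finite prefixes to finite prefixes.\<close>

context
  fixes h :: "'a list \<Rightarrow> 'a list" and a :: 'a and s :: "'a list"
  assumes mor: "word_morphism h" and ne: "\<And>c. h [c] \<noteq> []"
    and ha: "h [a] = a # s" and s: "s \<noteq> []"
begin

lemma iterate_append: "(h ^^ n) (u @ v) = (h ^^ n) u @ (h ^^ n) v"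
  using mor by (induction n) (auto simp: word_morphism_def)

lemma image_nonempty: "u \<noteq> [] \<Longrightarrow> h u \<noteq> []"
proof (cases u)
  case (Cons c v)
  have "h ([c] @ v) = h [c] @ h v" using mor unfolding word_morphism_def by blast
  then show ?thesis using ne[of c] Cons by simp
qed simp

lemma iterate_nonempty: "u \<noteq> [] \<Longrightarrow> (h ^^ n) u \<noteq> []"
  by (induction n) (auto simp: image_nonempty)

lemma iterate_Suc: "(h ^^ Suc n) [a] = (h ^^ n) [a] @ (h ^^ n) s"
proof -
  have "(h ^^ Suc n) [a] = (h ^^ n) ([a] @ s)"
    by (simp add: funpow_swap1 ha)
  then show ?thesis by (simp only: iterate_append)
qed

lemma iterate_length: "n < length ((h ^^ n) [a])"
proof (induction n)
  case (Suc n)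
  then show ?case using iterate_nonempty[OF s, of n] unfolding iterate_Suc
    by (cases "(h ^^ n) s") auto
qed simp

lemma iterate_prefix: "n \<le> m \<Longrightarrow> \<exists>y. (h ^^ m) [a] = (h ^^ n) [a] @ y"
proof (induction m rule: dec_induct)
  case (step m)
  then show ?case unfolding iterate_Suc by auto
qed simp

lemma iterate_nth:
  assumes "i < length ((h ^^ n) [a])"
  shows "(h ^^ i) [a] ! i = (h ^^ n) [a] ! i"
proof (cases "i \<le> n")
  case True
  then show ?thesis using iterate_prefix[OF True] iterate_length[of i] by (auto simp: nth_append)
next
  case False
  then show ?thesis using iterate_prefix[of n i] assms by (auto simp: nth_append)
qed

lemma omega_limit_ex1: "\<exists>!w. \<forall>n. prefix (length ((h ^^ n) [a])) w = (h ^^ n) [a]"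
proof (intro ex1I allI)
  fix n
  show "prefix (length ((h ^^ n) [a])) (\<lambda>i. (h ^^ i) [a] ! i) = (h ^^ n) [a]"
    by (rule nth_equalityI) (simp_all add: iterate_nth subsequence_def)
next
  fix w assume w: "\<forall>n. prefix (length ((h ^^ n) [a])) w = (h ^^ n) [a]"
  show "w = (\<lambda>i. (h ^^ i) [a] ! i)"
  proof
    fix i
    have "prefix (length ((h ^^ i) [a])) w ! i = w i"
      using iterate_length[of i] by (simp add: subsequence_def)
    then show "w i = (h ^^ i) [a] ! i" using w by simp
  qed
qed

lemma omega_limit_prefix:
  "prefix (length ((h ^^ n) [a])) (omega_limit h a) = (h ^^ n) [a]"
  using theI'[OF omega_limit_ex1] unfolding omega_limit_def by blast

lemma omega_limit_fixed_point:
  assumes u: "omega_limit h a = u \<frown> y"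
  shows "\<exists>z. omega_limit h a = h u \<frown> z"
proof -
  let ?n = "length u" and ?w = "omega_limit h a"
  have pre: "?w = (h ^^ n) [a] \<frown> suffix (length ((h ^^ n) [a])) ?w" for n
    using prefix_suffix[of ?w "length ((h ^^ n) [a])"] unfolding omega_limit_prefix .
  have "take ?n (prefix (length ((h ^^ ?n) [a])) ?w) = prefix ?n ?w"
    using iterate_length[of ?n] by (simp add: subsequence_def take_map)
  then have "take ?n ((h ^^ ?n) [a]) = u"
    unfolding omega_limit_prefix using u by simp
  then obtain v where "(h ^^ ?n) [a] = u @ v" by (metis append_take_drop_id)
  then have "(h ^^ Suc ?n) [a] = h u @ h v"
    using mor by (simp add: word_morphism_def)
  then show ?thesis using pre[of "Suc ?n"] by (metis conc_conc)
qed

end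

end

theory Submission
  imports Defs
begin

text \<open>The weight \<open>|u|\<^sub>a + 5 |u|\<^sub>b\<close> modulo 9 vanishes on all images \<open>h u\<close>, and the prefixes of the
  fixed point never have weight 5 or 8. The six cut points of an abelian fifth power have weights in
  arithmetic progression, so the common difference is 0, or two cut points that are three blocks apart
  both have weight 6 or both have weight 7. The latter two weights only occur inside a block \<open>h b\<close>;
  comparing the occurrences of \<open>b\<close> at these two places modulo 3 shows that the difference is 0 after all.
  But then all cut points can be shifted simultaneously to block boundaries, and since the incidence
  matrix of \<open>h\<close> is invertible the preimages form a shorter abelian fifth power.\<close>

section \<open>Prefix counts, progressions modulo 9, and short words\<close>

definition prefix_count :: "'a word \<Rightarrow> 'a \<Rightarrow> nat \<Rightarrow> int" where
  "prefix_count w c n = int (count_list (prefix n w) c)"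

lemma prefix_count_Suc:
  "prefix_count w c (Suc n) = prefix_count w c n + (if w n = c then 1 else 0)"
  by (simp add: prefix_count_def subsequence_def)

lemma prefix_count_mono: "m \<le> n \<Longrightarrow> prefix_count w c m \<le> prefix_count w c n"
  by (induction n rule: dec_induct) (auto simp: prefix_count_Suc)

lemma length_eq_count_letters: "length u = count_list u La + count_list u Lb"
proof (induction u)
  case (Cons c u)
  then show ?case by (cases c) auto
qed simp

text \<open>If \<open>g\<close> is a unit modulo 9, the excluded residues 5 and 8 sit 3 and 6 steps
  apart on the cycle generated by \<open>g\<close>, leaving gaps of only 2 and 5 terms, too short
  for six terms. If \<open>g\<close> is 3 or 6 modulo 9, the terms have period 3 and run through a
  whole class modulo 3; this is not the class of 5 and 8, so one of the first three terms is 6 or 7.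
  The proof simply checks all 81 pairs of residues.\<close>

lemma arithmetic_progression_mod_9:
  fixes r g :: int
  assumes "\<And>i::nat. i \<le> 5 \<Longrightarrow> (r + int i * g) mod 9 \<in> {0, 1, 2, 3, 4, 6, 7}"
  shows "g mod 9 = 0 \<or> (\<exists>i\<le>2. (r + int i * g) mod 9 \<in> {6, 7} \<and>
    (r + int (i + 3) * g) mod 9 = (r + int i * g) mod 9)"
proof -
  define P where "P a b i \<longleftrightarrow> (a + int i * b) mod 9 \<in> {0, 1, 2, 3, 4, 6, 7}" for a b i
  define Q where "Q a b i \<longleftrightarrow> (a + int i * b) mod 9 \<in> {6, 7} \<and>
    (a + int (i + 3) * b) mod 9 = (a + int i * b) mod 9" for a b i
  have red: "(r + int i * g) mod 9 = (r mod 9 + int i * (g mod 9)) mod 9" for i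
    by (intro mod_add_cong) (simp_all add: mod_mult_right_eq)
  have residues: "{0..8::int} = {0, 1, 2, 3, 4, 5, 6, 7, 8}" by auto
  have "\<forall>a\<in>{0..8}. \<forall>b\<in>{0..8}. P a b 0 \<and> P a b 1 \<and> P a b 2 \<and> P a b 3 \<and> P a b 4 \<and> P a b 5 \<longrightarrow>
      b = 0 \<or> Q a b 0 \<or> Q a b 1 \<or> Q a b 2"
    unfolding residues by (simp add: P_def Q_def)
  moreover have "r mod 9 \<in> {0..8}" "g mod 9 \<in> {0..8}" by auto
  moreover have "P (r mod 9) (g mod 9) i" if "i \<le> 5" for i
    using assms[OF that] unfolding P_def red .
  ultimately have "g mod 9 = 0 \<or> Q (r mod 9) (g mod 9) 0 \<or> Q (r mod 9) (g mod 9) 1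
      \<or> Q (r mod 9) (g mod 9) 2"
    by simp
  then have "g mod 9 = 0 \<or> (\<exists>i\<le>2. Q (r mod 9) (g mod 9) i)"
    by (metis le_refl one_le_numeral zero_le)
  then show ?thesis unfolding Q_def red .
qed

text \<open>Equal Parikh vectors make all blocks nonempty as soon as one is, and \<open>k\<close>
  nonempty blocks need length at least \<open>k\<close>.\<close>

lemma abelian_power_free_short:
  assumes "length u < k"
  shows "abelian_power_free k u"
  unfolding abelian_power_free_def
proof (intro allI impI, elim conjE)
  fix x vs y
  assume k: "length vs = k" and u: "u = x @ concat vs @ y"
    and eq: "\<forall>v\<in>set vs. \<forall>v'\<in>set vs. parikh v = parikh v'"
  show "\<forall>v\<in>set vs. v = []"
  proof (rule ccontr)
    assume "\<not> (\<forall>v\<in>set vs. v = [])"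
    then obtain v c where v: "v \<in> set vs" "c \<in> set v" by (meson last_in_set)
    have "v' \<noteq> []" if "v' \<in> set vs" for v'
    proof
      assume "v' = []"
      with eq v(1) that have "parikh v c = parikh [] c" by metis
      with v(2) show False by (simp add: parikh_def count_list_0_iff)
    qed
    then have "length vs \<le> length (concat vs)"
    proof (induction vs)
      case (Cons v vs)
      from Cons.prems[of v] have "length v \<ge> 1" by (cases v) auto
      moreover have "length vs \<le> length (concat vs)" using Cons by simp
      ultimately show ?case by simp
    qed simp
    with k u assms show False by simp
  qed
qed

section \<open>Block structure of the fixed point\<close>

context
  fixes h :: "letter list \<Rightarrow> letter list"
  assumes mor: "word_morphism h"
    and hLa: "h [La] = [La, La, La, La, Lb]"
    and hLb: "h [Lb] = [La, Lb, La, Lb, La, Lb]"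
begin

private abbreviation "w \<equiv> omega_limit h La"
private abbreviation "A \<equiv> prefix_count w La"
private abbreviation "B \<equiv> prefix_count w Lb"

lemma morphism_append: "h (u @ v) = h u @ h v"
  using mor by (simp add: word_morphism_def)

lemma image_letter_nonempty: "h [c] \<noteq> []"
  by (cases c) (simp_all add: hLa hLb)

lemma count_morphism:
  "count_list (h u) La = 4 * count_list u La + 3 * count_list u Lb"
  "count_list (h u) Lb = count_list u La + 3 * count_list u Lb"
proof (induction u)
  case Nil
  case 1 show ?case using mor by (simp add: word_morphism_def)
  case 2 show ?case using mor by (simp add: word_morphism_def)
next
  case (Cons c u)
  have step: "h (d # u) = h [d] @ h u" for d using morphism_append[of "[d]" u] by simp
  case 1 show ?case by (cases c) (simp_all add: step hLa hLb Cons.IH)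
  case 2 show ?case by (cases c) (simp_all add: step hLa hLb Cons.IH)
qed

lemma prefix_image: "prefix (length (h (prefix n w))) w = h (prefix n w)"
proof -
  have "w = prefix n w \<frown> suffix n w" by simp
  from omega_limit_fixed_point[OF mor image_letter_nonempty hLa _ this] obtain z where "w = h (prefix n w) \<frown> z"
    by auto
  then show ?thesis by (metis prefix_conc_length)
qed

lemma prefix_within_block:
  assumes "j \<le> length (h [w n])"
  shows "prefix (length (h (prefix n w)) + j) w = h (prefix n w) @ take j (h [w n])"
proof -
  have "prefix (Suc n) w = prefix n w @ [w n]" by (simp add: subsequence_def)
  then have "prefix (length (h (prefix n w)) + length (h [w n])) w = h (prefix n w) @ h [w n]"
    using prefix_image[of "Suc n"] by (simp add: morphism_append)
  then have "take (length (h (prefix n w)) + j)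
      (prefix (length (h (prefix n w)) + length (h [w n])) w) = h (prefix n w) @ take j (h [w n])"
    by simp
  with assms show ?thesis by (simp add: subsequence_def take_map)
qed

lemma block_decomposition:
  "\<exists>n j. j < length (h [w n]) \<and> m = length (h (prefix n w)) + j"
proof (induction m)
  case 0
  show ?case using mor image_letter_nonempty by (intro exI[of _ 0]) (simp add: word_morphism_def)
next
  case (Suc m)
  then obtain n j where nj: "j < length (h [w n])" "m = length (h (prefix n w)) + j" by blast
  show ?case
  proof (cases "Suc j < length (h [w n])")
    case True
    with nj show ?thesis by (intro exI[of _ n] exI[of _ "Suc j"]) simp
  next
    case False
    have "prefix (Suc n) w = prefix n w @ [w n]" by (simp add: subsequence_def)
    then show ?thesis using nj False image_letter_nonempty
      by (intro exI[of _ "Suc n"] exI[of _ 0]) (simp add: morphism_append)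
  qed
qed

lemma prefix_count_cases:
  obtains n j where
    "A m = 4 * A n + 3 * B n + int (count_list (take j (h [w n])) La)"
    "B m = A n + 3 * B n + int (count_list (take j (h [w n])) Lb)"
    "w m = h [w n] ! j" "j < length (h [w n])"
proof -
  obtain n j where nj: "j < length (h [w n])" "m = length (h (prefix n w)) + j"
    using block_decomposition by blast
  have "prefix m w = h (prefix n w) @ take j (h [w n])"
    using prefix_within_block[of j n] nj by simp
  then have "A m = 4 * A n + 3 * B n + int (count_list (take j (h [w n])) La)"
    "B m = A n + 3 * B n + int (count_list (take j (h [w n])) Lb)"
    by (simp_all add: prefix_count_def count_morphism)
  moreover have "w m = h [w n] ! j"
  proof -
    have "prefix (Suc m) w = h (prefix n w) @ take (Suc j) (h [w n])"
      using prefix_within_block[of "Suc j" n] nj by simp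
    moreover have "w m = prefix (Suc m) w ! m" by (simp del: subseq_to_Suc)
    ultimately show ?thesis using nj by (simp add: nth_append)
  qed
  ultimately show thesis using that nj by blast
qed

text \<open>A full block contributes 3 or 0 to the difference of the counts, so only the offset
  inside the current block matters modulo 3. Before the \<open>Lb\<close> of \<open>h [La]\<close>
  it is 4, before each \<open>Lb\<close> of \<open>h [Lb]\<close> it is 1.\<close>

lemma count_diff_before_Lb:
  assumes "w m = Lb"
  shows "(A m - B m) mod 3 = 1"
proof -
  obtain n j where nj:
    "A m = 4 * A n + 3 * B n + int (count_list (take j (h [w n])) La)"
    "B m = A n + 3 * B n + int (count_list (take j (h [w n])) Lb)"
    "w m = h [w n] ! j" "j < length (h [w n])"
    by (rule prefix_count_cases)
  have "int (count_list (take j (h [w n])) La) - int (count_list (take j (h [w n])) Lb) \<in> {1, 4}"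
  proof (cases "w n")
    case La
    then have "j = 0 \<or> j = 1 \<or> j = 2 \<or> j = 3 \<or> j = 4" using nj(4) by (auto simp: hLa)
    then show ?thesis using nj(3) assms La by (auto simp: hLa)
  next
    case Lb
    then have "j = 0 \<or> j = 1 \<or> j = 2 \<or> j = 3 \<or> j = 4 \<or> j = 5"
      using nj(4) by (auto simp: hLb)
    then show ?thesis using nj(3) assms Lb by (auto simp: hLb)
  qed
  then have "A m - B m = 1 + 3 * A n \<or> A m - B m = 1 + 3 * (A n + 1)"
    using nj(1,2) by auto
  then show ?thesis by (metis mod_mult_self2 mod_pos_pos_trivial one_less_numeral_iff semiring_norm(77) zero_le_one)
qed

text \<open>The offset of a prefix from a nearby block boundary depends on its weight only. For weights
  3 and 4 the boundary lies to the right, since \<open>aaa|ab\<close> and \<open>abab|ab\<close> agree there.\<close>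

definition offset_La :: "int \<Rightarrow> int" where
  "offset_La r = (if r = 1 \<or> r = 6 then 1 else if r = 2 \<or> r = 7 then 2 else if r = 3 then -1 else 0)"

definition offset_Lb :: "int \<Rightarrow> int" where
  "offset_Lb r = (if r = 6 \<or> r = 7 then 1 else if r = 3 \<or> r = 4 then -1 else 0)"

text \<open>Complete blocks have weight 9 or 18, so the weight is that of the part read of the
  current block: successively 0, 1, 2, 3, 4 inside \<open>h [La]\<close> and 0, 1, 6, 7, 3, 4 inside
  \<open>h [Lb]\<close>.\<close>

lemma prefix_weight:
  defines "r \<equiv> \<lambda>m. (A m + 5 * B m) mod 9"
  obtains n where "r m \<in> {0, 1, 2, 3, 4, 6, 7}"
    "A m = 4 * A n + 3 * B n + offset_La (r m)" "B m = A n + 3 * B n + offset_Lb (r m)"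
    "r m \<in> {6, 7} \<Longrightarrow> w n = Lb"
proof -
  obtain n j where nj:
    "A m = 4 * A n + 3 * B n + int (count_list (take j (h [w n])) La)"
    "B m = A n + 3 * B n + int (count_list (take j (h [w n])) Lb)"
    "j < length (h [w n])"
    by (rule prefix_count_cases)
  define p q where "p = int (count_list (take j (h [w n])) La)"
    and "q = int (count_list (take j (h [w n])) Lb)"
  have "A m + 5 * B m = p + 5 * q + 9 * (A n + 2 * B n)"
    using nj by (simp add: p_def q_def)
  then have r: "r m = (p + 5 * q) mod 9" unfolding r_def by (metis mod_mult_self2)
  show thesis
  proof (cases "w n")
    case La
    then have "j = 0 \<or> j = 1 \<or> j = 2 \<or> j = 3 \<or> j = 4" using nj(3) by (auto simp: hLa)
    with La have "(p, q) \<in> {(0, 0), (1, 0), (2, 0), (3, 0), (4, 0)}"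
      by (auto simp: p_def q_def hLa)
    \<comment> \<open>The witness is \<open>Suc n\<close> for weights 3 and 4, and \<open>n\<close>
      otherwise.\<close>
    then show thesis
      using that[of n] that[of "Suc n"] nj(1,2) La r unfolding p_def[symmetric] q_def[symmetric]
      by (auto simp: offset_La_def offset_Lb_def prefix_count_Suc)
  next
    case Lb
    then have "j = 0 \<or> j = 1 \<or> j = 2 \<or> j = 3 \<or> j = 4 \<or> j = 5"
      using nj(3) by (auto simp: hLb)
    with Lb have "(p, q) \<in> {(0, 0), (1, 0), (1, 1), (2, 1), (2, 2), (3, 2)}"
      by (auto simp: p_def q_def hLb)
    then show thesis
      using that[of n] that[of "Suc n"] nj(1,2) Lb r unfolding p_def[symmetric] q_def[symmetric]
      by (auto simp: offset_La_def offset_Lb_def prefix_count_Suc)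
  qed
qed

section \<open>The fixed point: descent for abelian fifth powers, and the factor
  \<open>bb\<close>\<close>

lemma no_five_equal_steps:
  assumes "\<And>i. i \<le> 5 \<Longrightarrow> A (s i) = a0 + int i * p"
    and "\<And>i. i \<le> 5 \<Longrightarrow> B (s i) = b0 + int i * q"
    and "p + q > 0"
  shows False
  using assms
\<comment> \<open>Only the counts at the cut points enter, with integer steps and no order imposed
  on \<open>s\<close>. Thus the induction hypothesis applies directly to the block boundaries
  \<open>t (s i)\<close>, without rebuilding words.\<close>
proof (induction "nat (p + q)" arbitrary: s a0 b0 p q rule: less_induct)
  case less
  define r where "r = (\<lambda>m. (A m + 5 * B m) mod 9)"
  have "\<exists>n. r m \<in> {0, 1, 2, 3, 4, 6, 7} \<and>
    A m = 4 * A n + 3 * B n + offset_La (r m) \<and> B m = A n + 3 * B n + offset_Lb (r m) \<and>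
    (r m \<in> {6, 7} \<longrightarrow> w n = Lb)" for m
    using prefix_weight[of m] unfolding r_def by metis
  then obtain t where t: "r m \<in> {0, 1, 2, 3, 4, 6, 7}"
    "A m = 4 * A (t m) + 3 * B (t m) + offset_La (r m)"
    "B m = A (t m) + 3 * B (t m) + offset_Lb (r m)"
    "r m \<in> {6, 7} \<Longrightarrow> w (t m) = Lb" for m
    by metis
  define g where "g = p + 5 * q"
  have rs: "r (s i) = (a0 + 5 * b0 + int i * g) mod 9" if "i \<le> 5" for i
    using less.prems(1,2)[OF that] by (simp add: r_def g_def algebra_simps)
  have "g mod 9 = 0"
  proof (rule ccontr)
    assume "g mod 9 \<noteq> 0"
    moreover have "(a0 + 5 * b0 + int i * g) mod 9 \<in> {0, 1, 2, 3, 4, 6, 7}" if "i \<le> 5" for i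
      using t(1)[of "s i"] unfolding rs[OF that] .
    ultimately obtain i where "i \<le> 2" "(a0 + 5 * b0 + int i * g) mod 9 \<in> {6, 7}"
      "(a0 + 5 * b0 + int (i + 3) * g) mod 9 = (a0 + 5 * b0 + int i * g) mod 9"
      using arithmetic_progression_mod_9[of "a0 + 5 * b0" g] by blast
    then have i: "i \<le> 2" "r (s i) \<in> {6, 7}" "r (s (i + 3)) = r (s i)"
      using rs[of i] rs[of "i + 3"] by simp_all
    let ?m = "t (s i)" and ?n = "t (s (i + 3))"
    define x y where "x = A ?n - A ?m" and "y = B ?n - B ?m"
    have "A (s (i + 3)) - A (s i) = 3 * p" "B (s (i + 3)) - B (s i) = 3 * q"
      using i(1) less.prems(1)[of i] less.prems(1)[of "i + 3"]
        less.prems(2)[of i] less.prems(2)[of "i + 3"] by (simp_all add: algebra_simps)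
    \<comment> \<open>Equal weights give equal offsets, which cancel.\<close>
    then have "4 * x + 3 * y = 3 * p" "x + 3 * y = 3 * q"
      using t(2,3)[of "s i"] t(2,3)[of "s (i + 3)"] i(3) by (simp_all add: x_def y_def)
    moreover have "(A ?m - B ?m) mod 3 = 1" "(A ?n - B ?n) mod 3 = 1"
      using count_diff_before_Lb t(4) i by metis+
    then have "(x - y) mod 3 = 0"
      using mod_diff_eq[of "A ?n - B ?n" 3 "A ?m - B ?m"] by (simp add: x_def y_def algebra_simps)
    then obtain k where "x - y = 3 * k" unfolding mod_eq_0_iff_dvd dvd_def by blast
    \<comment> \<open>Adding the first equation to five times the second gives
      \<open>g = 3 * x + 6 * y\<close>; then substitute \<open>x = y + 3 * k\<close>.\<close>
    ultimately have "g = 9 * (y + k)" unfolding g_def by algebra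
    then have "g mod 9 = 0" by simp
    with \<open>g mod 9 \<noteq> 0\<close> show False ..
  qed
  then obtain k where k: "g = 9 * k" unfolding mod_eq_0_iff_dvd dvd_def by blast
  \<comment> \<open>All six cut points now have the same weight, hence the same offsets, so passing
    to the boundaries preserves the differences.\<close>
  have r0: "r (s i) = r (s 0)" if "i \<le> 5" for i
    using rs[OF that] rs[of 0] unfolding k by (simp add: mult.left_commute[of _ 9])
  define a1 b1 where "a1 = A (t (s 0))" and "b1 = B (t (s 0))"
  define x y where "x = A (t (s 1)) - a1" and "y = B (t (s 1)) - b1"
  have lin: "4 * A (t (s i)) + 3 * B (t (s i)) = 4 * a1 + 3 * b1 + int i * p"
    "A (t (s i)) + 3 * B (t (s i)) = a1 + 3 * b1 + int i * q" if "i \<le> 5" for i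
    using t(2,3)[of "s i"] t(2,3)[of "s 0"] r0[OF that]
      less.prems(1)[OF that] less.prems(1)[of 0] less.prems(2)[OF that] less.prems(2)[of 0]
    by (simp_all add: a1_def b1_def)
  have pq: "p = 4 * x + 3 * y" "q = x + 3 * y"
    using lin[of 1] by (simp_all add: x_def y_def)
  \<comment> \<open>The incidence matrix has determinant 9, so the two linear equations determine
    both counts.\<close>
  have 1: "A (t (s i)) = a1 + int i * x" and 2: "B (t (s i)) = b1 + int i * y" if "i \<le> 5" for i
    using lin[OF that] unfolding pq by (simp_all add: algebra_simps)
  \<comment> \<open>Prefix counts are monotone, so \<open>x\<close> and \<open>y\<close> cannot have
    opposite signs; \<open>p + q = 5 * x + 6 * y > 0\<close> then rules out the reversed order and
    yields the strict descent.\<close>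
  have "t (s 0) \<le> t (s 1)"
  proof (rule ccontr)
    assume "\<not> ?thesis"
    then have "x \<le> 0" "y \<le> 0"
      using prefix_count_mono[of "t (s 1)" "t (s 0)" w] by (simp_all add: x_def y_def a1_def b1_def)
    then show False using less.prems(3) pq by simp
  qed
  then have "x \<ge> 0" "y \<ge> 0"
    using prefix_count_mono[of "t (s 0)" "t (s 1)" w] by (simp_all add: x_def y_def a1_def b1_def)
  moreover from this have "x + y > 0" using less.prems(3) pq by linarith
  ultimately have "nat (x + y) < nat (p + q)" using pq by linarith
  from less.hyps[OF this 1 2 \<open>x + y > 0\<close>] show False .
qed

lemma omega_limit_abelian_5_power_free: "omega_abelian_power_free 5 w"
  unfolding omega_abelian_power_free_def
proof (intro allI impI ballI, elim conjE)
  fix x vs y v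
  assume len: "length vs = 5" and wd: "w = x \<frown> concat vs \<frown> y"
    and eq: "\<forall>v\<in>set vs. \<forall>v'\<in>set vs. parikh v = parikh v'" and v: "v \<in> set vs"
  \<comment> \<open>The six cut points, \<open>s 0\<close> to \<open>s 5\<close>, delimit the five
    blocks.\<close>
  define s where "s i = length (x @ concat (take i vs))" for i
  have cnt: "prefix_count w c (s i) = int (count_list x c) + int i * int (count_list v c)"
    if "i \<le> 5" for c i
  proof -
    have "w = (x @ concat (take i vs)) \<frown> concat (drop i vs) \<frown> y"
      using wd by (metis append_take_drop_id concat_append conc_conc)
    then have "prefix (s i) w = x @ concat (take i vs)"
      unfolding s_def by (metis prefix_conc_length)
    moreover have "count_list (concat us) c = length us * count_list v c" if "set us \<subseteq> set vs" for us
      using that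
    proof (induction us)
      case (Cons u us)
      then have "u \<in> set vs" by simp
      then have "parikh u = parikh v" using eq v by blast
      then have "count_list u c = count_list v c" by (metis parikh_def)
      with Cons show ?case by simp
    qed simp
    from this[of "take i vs"] have "count_list (concat (take i vs)) c = i * count_list v c"
      using that len by (simp add: set_take_subset)
    ultimately show ?thesis by (simp add: prefix_count_def)
  qed
  show "v = []"
  proof (rule ccontr)
    assume "v \<noteq> []"
    then have "int (count_list v La) + int (count_list v Lb) > 0"
      using length_eq_count_letters[of v] by (cases v) auto
    from no_five_equal_steps[OF cnt cnt this] show False .
  qed
qed

text \<open>Reading the first \<open>Lb\<close> lowers the difference of the counts by 1, so it
  cannot be 1 modulo 3 before both letters.\<close>

lemma omega_limit_no_LbLb: "\<not> omega_factor [Lb, Lb] w"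
proof
  assume "omega_factor [Lb, Lb] w"
  then obtain x y where w: "w = x \<frown> [Lb, Lb] \<frown> y" by (auto simp: omega_factor_def)
  let ?n = "length x"
  have "w ?n = Lb" "w (Suc ?n) = Lb" unfolding w by simp_all
  then have "(A ?n - B ?n) mod 3 = 1" "(A ?n - (B ?n + 1)) mod 3 = 1"
    using count_diff_before_Lb[of ?n] count_diff_before_Lb[of "Suc ?n"]
    by (simp_all add: prefix_count_Suc)
  moreover have "(u - (v + 1)) mod 3 \<noteq> 1" if "(u - v) mod 3 = 1" for u v :: int
    using that by presburger
  ultimately show False by blast
qed

section \<open>Failure of power freeness for the morphism\<close>

lemma image_replicate_Lb: "h (replicate n Lb) = concat (replicate (3 * n) [La, Lb])"
proof (induction n)
  case (Suc n)
  then show ?case using morphism_append[of "[Lb]" "replicate n Lb"]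
    by (simp add: hLb numeral_3_eq_3)
qed (use mor in \<open>simp add: word_morphism_def\<close>)

text \<open>The witness is the word of \<open>k - 1\<close> letters \<open>Lb\<close>: it is too
  short to contain a nonempty abelian \<open>k\<close>-th power, but its image consists of
  \<open>3 * (k - 1)\<close> copies of \<open>[La, Lb]\<close>, which is at least \<open>k\<close>
  copies when \<open>k\<close> is at least 2.\<close>

lemma not_abelian_power_free_morphism:
  assumes "k \<ge> 2"
  shows "\<not> abelian_power_free_morphism k h"
proof
  assume "abelian_power_free_morphism k h"
  moreover have "abelian_power_free k (replicate (k - 1) Lb)"
    using assms by (intro abelian_power_free_short) simp
  ultimately have free: "abelian_power_free k (concat (replicate (3 * (k - 1)) [La, Lb]))"
    unfolding abelian_power_free_morphism_def using image_replicate_Lb by metis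
  have "3 * (k - 1) = k + (2 * k - 3)" using assms by simp
  then have "concat (replicate (3 * (k - 1)) [La, Lb])
      = [] @ concat (replicate k [La, Lb]) @ concat (replicate (2 * k - 3) [La, Lb])"
    by (simp add: replicate_add)
  with free have "\<forall>v\<in>set (replicate k [La, Lb]). v = []"
    unfolding abelian_power_free_def by (metis in_set_replicate length_replicate)
  then show False using assms by simp
qed

end

theorem theorem5p1:
  fixes h :: "letter list \<Rightarrow> letter list"
  assumes "word_morphism h"
    and "h [La] = [La, La, La, La, Lb]"
    and "h [Lb] = [La, Lb, La, Lb, La, Lb]"
  shows "omega_abelian_power_free 5 (omega_limit h La)
       \<and> \<not> omega_factor [Lb, Lb] (omega_limit h La)
       \<and> (\<forall>k\<ge>2. \<not> abelian_power_free_morphism k h)"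
  using omega_limit_abelian_5_power_free[OF assms] omega_limit_no_LbLb[OF assms]
    not_abelian_power_free_morphism[OF assms] by blast

end
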